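(* Let $f\in\mathcal{A}$. (i) Suppose that $\frac{zf'(z)}{f(z)}$ and $1+\frac{zf''(z)}{f'(z)}$ are analytic in $\mathbb{D}$. If \[\left| \frac{zf'(z)}{f(z)} \left[ 2 + \frac{zf''(z)}{f'(z)} \right] -2 \right| < \frac52 \quad\text{for all } z\in\mathbb{D},\] then $f\in\mathcal{S}^*$. (ii) Suppose that $1+\frac{zf''(z)}{f'(z)}$ is analytic in $\mathbb{D}$. If \[\left| \frac{z^2f'''(z)}{f'(z)} + 4\frac{zf''(z)}{f'(z)} \right| < \frac52 \quad\text{for all } z\in\mathbb{D},\] then $f\in\mathcal{K}$. (iii) If \[\left| zf''(z) + f'(z) + (f'(z))^2 -2 \right| < \frac52 \quad\text{for all } z\in\mathbb{D},\] then $\operatorname{Re} f'(z)>0$ for all $z\in\mathbb{D}$. (iv) If \[\left| f'(z) + \left[ \frac{f(z)}{z} \right]^2 -2 \right| < \frac52 \quad\text{for all } z\in\mathbb{D},\] then $\operatorname{Re}\frac{f(z)}{z}>0$ for all $z\in\mathbb{D}$.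
   Context: $\mathbb{D}=\{z\in\mathbb{C}:|z|<1\}$ is the open unit disk. $\mathcal{A}$ is the class of functions $f$ analytic in $\mathbb{D}$ with $f(0)=0$ and $f'(0)=1$. The classes of starlike and convex functions are $\mathcal{S}^*=\{f\in\mathcal{A}: \operatorname{Re}\frac{zf'(z)}{f(z)}>0 \text{ for all } z\in\mathbb{D}\}$ and $\mathcal{K}=\{f\in\mathcal{A}: \operatorname{Re}\left[1+\frac{zf''(z)}{f'(z)}\right]>0 \text{ for all } z\in\mathbb{D}\}$. At $z=0$ the quotients $\frac{zf'(z)}{f(z)}$ and $\frac{f(z)}{z}$ are given their limiting value $1$. Saying that $\frac{zf'(z)}{f(z)}$ is analytic in $\mathbb{D}$ means that $f(z)\neq0$ for $z\in\mathbb{D}\setminus\{0\}$, and saying that $1+\frac{zf''(z)}{f'(z)}$ is analytic in $\mathbb{D}$ means that $f'(z)\ne 0$ for $z\in\mathbb{D}$. *)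

theory Defs
  imports "HOL-Complex_Analysis.Complex_Analysis"
begin

abbreviation unit_disk :: "complex set" where
  "unit_disk \<equiv> ball 0 1"

definition class_A :: "(complex \<Rightarrow> complex) set" where
  "class_A = {f. f analytic_on unit_disk \<and> f 0 = 0 \<and> deriv f 0 = 1}"

(* The two quotients below are 0/0 at the origin, where they take their limiting value 1;
   see the two limit lemmas. *)

definition starlike_quot :: "(complex \<Rightarrow> complex) \<Rightarrow> complex \<Rightarrow> complex" where
  "starlike_quot f z = (if z = 0 then 1 else z * deriv f z / f z)"

definition ratio_quot :: "(complex \<Rightarrow> complex) \<Rightarrow> complex \<Rightarrow> complex" where
  "ratio_quot f z = (if z = 0 then 1 else f z / z)"

definition convex_quot :: "(complex \<Rightarrow> complex) \<Rightarrow> complex \<Rightarrow> complex" where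
  "convex_quot f z = 1 + z * (deriv ^^ 2) f z / deriv f z"

(* Division by zero yields 0 in HOL, so the nonvanishing of the denominators, which is
   implicit in the quotients being defined and analytic, is made explicit. Without it a zero
   of the derivative would satisfy the condition for convexity vacuously. *)

definition starlike_quot_analytic :: "(complex \<Rightarrow> complex) \<Rightarrow> bool" where
  "starlike_quot_analytic f \<longleftrightarrow> (\<forall>z\<in>unit_disk - {0}. f z \<noteq> 0)"

definition convex_quot_analytic :: "(complex \<Rightarrow> complex) \<Rightarrow> bool" where
  "convex_quot_analytic f \<longleftrightarrow> (\<forall>z\<in>unit_disk. deriv f z \<noteq> 0)"

definition starlike_class :: "(complex \<Rightarrow> complex) set" where
  "starlike_class = {f \<in> class_A. starlike_quot_analytic f \<and>
     (\<forall>z\<in>unit_disk. Re (starlike_quot f z) > 0)}"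

definition convex_class :: "(complex \<Rightarrow> complex) set" where
  "convex_class = {f \<in> class_A. convex_quot_analytic f \<and>
     (\<forall>z\<in>unit_disk. Re (convex_quot f z) > 0)}"

lemma ratio_quot_limit:
  assumes "f \<in> class_A"
  shows "((\<lambda>z. f z / z) \<longlongrightarrow> ratio_quot f 0) (at 0)"
proof -
  have "f field_differentiable at 0"
    using assms by (auto simp: class_A_def analytic_on_imp_differentiable_at)
  hence "(f has_field_derivative 1) (at 0)"
    using assms by (metis (mono_tags, lifting) DERIV_deriv_iff_field_differentiable class_A_def mem_Collect_eq)
  thus ?thesis
    using assms by (simp add: class_A_def has_field_derivative_iff ratio_quot_def)
qed

lemma starlike_quot_limit:
  assumes "f \<in> class_A"
  shows "((\<lambda>z. z * deriv f z / f z) \<longlongrightarrow> starlike_quot f 0) (at 0)"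
proof -
  have hol: "f holomorphic_on unit_disk" and d0: "deriv f 0 = 1"
    using assms by (auto simp: class_A_def analytic_on_open)
  have "deriv f holomorphic_on unit_disk"
    using hol by (intro holomorphic_deriv) auto
  hence "continuous_on unit_disk (deriv f)"
    by (rule holomorphic_on_imp_continuous_on)
  hence "isCont (deriv f) 0"
    by (simp add: continuous_on_eq_continuous_at)
  hence "(deriv f \<longlongrightarrow> 1) (at 0)"
    using d0 by (simp add: isCont_def)
  moreover have "((\<lambda>z. f z / z) \<longlongrightarrow> 1) (at 0)"
    using ratio_quot_limit[OF assms] by (simp add: ratio_quot_def)
  ultimately have "((\<lambda>z. deriv f z / (f z / z)) \<longlongrightarrow> 1 / 1) (at 0)"
    by (intro tendsto_divide) auto
  thus ?thesis by (simp add: starlike_quot_def mult.commute)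
qed

lemma starlike_quot_analytic_imp:
  assumes "f \<in> class_A" "starlike_quot_analytic f"
  shows "starlike_quot f analytic_on unit_disk"
proof -
  have "f holomorphic_on unit_disk"
    using assms by (simp add: class_A_def analytic_on_open)
  hence "(\<lambda>z. z * deriv f z / f z) holomorphic_on unit_disk - {0}"
    using assms(2) unfolding starlike_quot_analytic_def
    by (intro holomorphic_intros holomorphic_deriv)
      (auto intro: holomorphic_on_subset)
  hence "starlike_quot f holomorphic_on unit_disk - {0}"
    by (rule holomorphic_transform) (simp add: starlike_quot_def)
  moreover have "(starlike_quot f \<longlongrightarrow> starlike_quot f z) (at z within unit_disk)"
    if "z \<in> {0}" for z
  proof -
    have "\<forall>\<^sub>F w in at 0. w * deriv f w / f w = starlike_quot f w"
      unfolding eventually_at_filter by (rule always_eventually) (simp add: starlike_quot_def)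
    hence "(starlike_quot f \<longlongrightarrow> starlike_quot f 0) (at 0)"
      using starlike_quot_limit[OF assms(1)] by (rule Lim_transform_eventually[rotated])
    thus ?thesis
      using that by (metis at_le singletonD subset_UNIV tendsto_mono)
  qed
  ultimately have "starlike_quot f holomorphic_on unit_disk"
    using no_isolated_singularity'[of "{0}" "starlike_quot f" unit_disk] by blast
  thus ?thesis by (simp add: analytic_on_open)
qed

lemma convex_quot_analytic_imp:
  assumes "f \<in> class_A" "convex_quot_analytic f"
  shows "convex_quot f analytic_on unit_disk"
proof -
  have hol: "f holomorphic_on unit_disk"
    using assms by (simp add: class_A_def analytic_on_open)
  have "(\<lambda>z. 1 + z * (deriv ^^ 2) f z / deriv f z) holomorphic_on unit_disk"
    using assms(2) hol unfolding convex_quot_analytic_def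
    by (intro holomorphic_intros holomorphic_higher_deriv holomorphic_deriv) auto
  moreover have "convex_quot f = (\<lambda>z. 1 + z * (deriv ^^ 2) f z / deriv f z)"
    by (simp add: fun_eq_iff convex_quot_def)
  ultimately show ?thesis by (simp add: analytic_on_open)
qed

end

theory Submission
  imports Defs
begin

text \<open>
  All four parts are instances of one differential subordination. For a function \<open>p\<close> holomorphic
  in the disk with \<open>p 0 = 1\<close>, the bound
  \<open>norm (p z ^ 2 + p z + z * deriv p z - 2) < 5 / 2\<close> forces \<open>Re (p z) > 0\<close>. Choosing for \<open>p\<close> the
  functions \<open>z f' / f\<close>, \<open>1 + z f'' / f'\<close>, \<open>f'\<close> and \<open>f / z\<close> turns the bounded expression into the
  four expressions of the theorem.

  The subordination rests on Hopf's boundary point argument. If \<open>Re p\<close> is not positive everywhere,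
  take a point \<open>z0\<close> of least modulus with \<open>Re (p z0) \<le> 0\<close>. Inside the circle through \<open>z0\<close> the
  real part is positive, so Harnack's inequality (a consequence of the Schwarz lemma) bounds it
  below by \<open>(1 - t) / (1 + t)\<close> at \<open>t * z0\<close>. Hence \<open>Re p\<close> vanishes at \<open>z0\<close> and descends there along
  the radius with slope at most \<open>-1/2\<close>, the slope of \<open>(1 - t) / (1 + t)\<close> at \<open>t = 1\<close>
  (lemma \<open>Hopf_boundary_point\<close>).
  At \<open>z0\<close> the number \<open>p z0\<close> is imaginary, its square is at most \<open>0\<close>, and so the real part of the
  bounded expression is at most \<open>0 + 0 - 1/2 - 2 = -5/2\<close>, which contradicts the bound
  (lemma \<open>Re_pos_of_subordination\<close>).
\<close>

section \<open>Boundary behaviour of functions with positive real part\<close>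

text \<open>
  The Cayley transform \<open>(1 - q) / (1 + q)\<close> maps the right half-plane to the disk and sends \<open>1\<close> to
  \<open>0\<close>, so the Schwarz lemma bounds it by the modulus of the argument; solving that bound for the
  real part of \<open>q\<close> gives the estimate.
\<close>

lemma Harnack_lower_bound:
  fixes q :: "complex \<Rightarrow> complex"
  assumes hol: "q holomorphic_on ball 0 1" and q0: "q 0 = 1"
    and pos: "\<And>z. z \<in> ball 0 1 \<Longrightarrow> Re (q z) > 0"
    and z: "z \<in> ball 0 1"
  shows "(1 - norm z) / (1 + norm z) \<le> Re (q z)"
proof -
  define w where "w = (\<lambda>z. (1 - q z) / (1 + q z))"
  have nz: "1 + q z \<noteq> 0" if "z \<in> ball 0 1" for z
    using pos[OF that] by (auto simp: complex_eq_iff)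
  have "w holomorphic_on ball 0 1"
    unfolding w_def using nz by (intro holomorphic_intros hol) auto
  moreover have "norm (w z) < 1" if "norm z < 1" for z
  proof -
    have P: "Re (q z) > 0" and N: "1 + q z \<noteq> 0"
      using pos[of z] nz[of z] that by auto
    have "norm (1 - q z) ^ 2 < norm (1 + q z) ^ 2"
      unfolding cmod_power2 using P by (simp add: power2_eq_square algebra_simps)
    hence "norm (1 - q z) < norm (1 + q z)"
      by (rule power_less_imp_less_base) simp
    thus ?thesis using N by (simp add: w_def norm_divide)
  qed
  ultimately have "norm (w z) \<le> norm z"
    using Schwarz_Lemma(1)[of w z] q0 z by (simp add: w_def)
  hence "norm (1 - q z) \<le> norm z * norm (1 + q z)"
    using nz[OF z] by (simp add: w_def norm_divide divide_le_eq)
  hence "norm (1 - q z) ^ 2 \<le> (norm z * norm (1 + q z)) ^ 2"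
    by (rule power_mono) simp
  hence sq: "(1 - Re (q z))\<^sup>2 + (Im (q z))\<^sup>2
      \<le> (norm z)\<^sup>2 * (1 + Re (q z))\<^sup>2 + (norm z)\<^sup>2 * (Im (q z))\<^sup>2"
    unfolding power_mult_distrib cmod_power2[of "1 - q z"] cmod_power2[of "1 + q z"]
    by (simp add: algebra_simps)
  have "(norm z)\<^sup>2 * (Im (q z))\<^sup>2 \<le> 1 * (Im (q z))\<^sup>2"
    using z by (intro mult_right_mono) (auto simp: abs_square_le_1)
  with sq have "(1 - Re (q z))\<^sup>2 \<le> (norm z * (1 + Re (q z)))\<^sup>2"
    by (simp add: power_mult_distrib)
  hence "1 - Re (q z) \<le> norm z * (1 + Re (q z))"
    by (rule power2_le_imp_le) (use pos[OF z] in simp)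
  moreover have "0 < 1 + norm z"
    by (rule add_pos_nonneg) simp_all
  ultimately show ?thesis
    by (simp add: divide_le_eq algebra_simps)
qed

text \<open>
  At a point of least modulus where the real part fails to be positive, Harnack's inequality on
  the disk through that point forces a strictly negative radial derivative.
\<close>

lemma Hopf_boundary_point:
  fixes p :: "complex \<Rightarrow> complex"
  assumes hol: "p holomorphic_on ball 0 1" and p0: "p 0 = 1"
    and z1: "z1 \<in> ball 0 1" and le: "Re (p z1) \<le> 0"
  obtains z0 where "z0 \<in> ball 0 1" "z0 \<noteq> 0" "Re (p z0) = 0" "Re (z0 * deriv p z0) \<le> - 1 / 2"
proof -
  define K where "K = {z \<in> cball 0 (norm z1). Re (p z) \<le> 0}"
  have sub: "cball 0 (norm z1) \<subseteq> ball (0::complex) 1"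
    using z1 by auto
  have "continuous_on (cball 0 (norm z1)) (\<lambda>z. Re (p z))"
    using holomorphic_on_imp_continuous_on[OF hol] sub
    by (intro continuous_intros) (auto intro: continuous_on_subset)
  hence "closed (cball 0 (norm z1) \<inter> (\<lambda>z. Re (p z)) -` {..0})"
    by (rule continuous_closed_preimage) auto
  moreover have "K = cball 0 (norm z1) \<inter> (\<lambda>z. Re (p z)) -` {..0}"
    by (auto simp: K_def)
  ultimately have "compact K"
    by (metis Int_lower1 bounded_cball bounded_subset compact_eq_bounded_closed)
  moreover have "z1 \<in> K"
    using le by (simp add: K_def)
  ultimately obtain z0 where z0: "z0 \<in> K" and min: "\<And>z. z \<in> K \<Longrightarrow> norm z0 \<le> norm z"
    using continuous_attains_inf[of K norm] by (metis continuous_on_norm_id empty_iff)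
  have z0_disk: "z0 \<in> ball 0 1" and z0_le: "Re (p z0) \<le> 0"
    using z0 sub by (auto simp: K_def)
  have z0_nz: "z0 \<noteq> 0"
    using z0_le p0 by auto
  have pos: "Re (p z) > 0" if "norm z < norm z0" for z
    using min[of z] that z0 unfolding K_def by (cases "Re (p z) \<le> 0") auto
  define q where "q = (\<lambda>\<zeta>. p (\<zeta> * z0))"
  have scaled: "norm (\<zeta> * z0) < norm z0" if "norm \<zeta> < 1" for \<zeta>
    using that z0_nz by (simp add: norm_mult)
  have "q holomorphic_on ball 0 1"
    unfolding q_def
    by (rule holomorphic_on_compose_gen[OF _ hol, unfolded o_def])
      (use scaled z0_disk in \<open>force intro!: holomorphic_intros\<close>)+
  hence harnack: "(1 - t) / (1 + t) \<le> Re (p (of_real t * z0))" if "0 \<le> t" "t < 1" for t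
    using Harnack_lower_bound[of q "of_real t"] that p0 pos scaled by (simp add: q_def)
  define g where "g = (\<lambda>t. Re (p (of_real t * z0)) - (1 - t) / (1 + t))"
  have dp: "(p has_field_derivative deriv p z0) (at z0)"
    using hol z0_disk by (auto intro: holomorphic_derivI)
  have "((\<lambda>t. of_real t * z0) has_vector_derivative z0) (at 1)"
    by (auto intro!: derivative_eq_intros)
  hence "((p \<circ> (\<lambda>t. of_real t * z0)) has_vector_derivative z0 * deriv p z0) (at 1)"
    by (rule field_vector_diff_chain_at) (use dp in simp)
  hence dRe: "((\<lambda>t. Re (p (of_real t * z0))) has_real_derivative Re (z0 * deriv p z0)) (at 1)"
    by (simp add: has_vector_derivative_complex_iff o_def)
  have dg: "(g has_real_derivative Re (z0 * deriv p z0) + 1 / 2) (at 1)"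
    unfolding g_def by (rule derivative_eq_intros dRe refl | simp)+
  have g_nonneg: "0 \<le> g t" if "0 \<le> t" "t < 1" for t
    using harnack[OF that] by (simp add: g_def)
  have g1: "g 1 = Re (p z0)"
    by (simp add: g_def)
  have "(g \<longlongrightarrow> g 1) (at_left 1)"
    using DERIV_isCont[OF dg] by (simp add: isCont_def filterlim_at_split)
  moreover have "\<forall>\<^sub>F t in at_left 1. 0 \<le> g t"
    using eventually_at_left_real[OF zero_less_one] by eventually_elim (auto intro: g_nonneg)
  ultimately have "0 \<le> g 1"
    by (rule tendsto_lowerbound) simp
  hence zero: "Re (p z0) = 0"
    using g1 z0_le by simp
  \<comment> \<open>A positive slope at \<open>1\<close> would make \<open>g\<close> negative just to the left of its zero.\<close>
  have "Re (z0 * deriv p z0) + 1 / 2 \<le> 0"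
  proof (rule ccontr)
    assume "\<not> ?thesis"
    then obtain d where d: "d > 0" "\<And>h. 0 < h \<Longrightarrow> h < d \<Longrightarrow> g (1 - h) < g 1"
      using DERIV_pos_inc_left[OF dg] by auto
    have "g (1 - min (d / 2) 1) < 0"
      using d(2)[of "min (d / 2) 1"] d(1) g1 zero by auto
    thus False
      using g_nonneg[of "1 - min (d / 2) 1"] d(1) by auto
  qed
  with that[OF z0_disk z0_nz zero] show thesis
    by simp
qed

text \<open>
  The bound \<open>5 / 2\<close> is the sum of the constant \<open>2\<close> and the guaranteed descent \<open>1 / 2\<close> at a boundary
  point, where \<open>p\<close> is imaginary and its square can only lower the real part further.
\<close>

lemma Re_pos_of_subordination:
  fixes p :: "complex \<Rightarrow> complex"
  assumes hol: "p holomorphic_on ball 0 1" and p0: "p 0 = 1"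
    and bound: "\<And>z. z \<in> ball 0 1 \<Longrightarrow> z \<noteq> 0 \<Longrightarrow>
      norm ((p z)\<^sup>2 + p z + z * deriv p z - 2) < 5 / 2"
    and z: "z \<in> ball 0 1"
  shows "Re (p z) > 0"
proof (rule ccontr)
  assume "\<not> Re (p z) > 0"
  then obtain z0 where z0: "z0 \<in> ball 0 1" "z0 \<noteq> 0" "Re (p z0) = 0"
      "Re (z0 * deriv p z0) \<le> - 1 / 2"
    using Hopf_boundary_point[OF hol p0 z] by (auto simp: not_less)
  define E where "E = (p z0)\<^sup>2 + p z0 + z0 * deriv p z0 - 2"
  have "Re E = - (Im (p z0))\<^sup>2 + Re (z0 * deriv p z0) - 2"
    using z0(3) by (simp add: E_def power2_eq_square)
  also have "\<dots> \<le> - 5 / 2"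
    using z0(4) zero_le_power2[of "Im (p z0)"] by linarith
  finally have "5 / 2 \<le> norm E"
    using abs_Re_le_cmod[of E] by linarith
  thus False
    using bound[OF z0(1,2)] by (simp add: E_def)
qed

section \<open>Quotients attached to a normalised function\<close>

text \<open>
  The logarithmic derivative of \<open>p = z f' / f\<close> gives \<open>z p' / p = 1 + z f'' / f' - p\<close>;
  inserting this in \<open>p (p + 1 + z p' / p)\<close> cancels the quadratic term.
\<close>

lemma starlike_quot_subordination:
  assumes f: "f \<in> class_A" and fnz: "starlike_quot_analytic f" and dnz: "convex_quot_analytic f"
    and z: "z \<in> unit_disk" "z \<noteq> 0"
  shows "(starlike_quot f z)\<^sup>2 + starlike_quot f z + z * deriv (starlike_quot f) z
    = starlike_quot f z * (2 + z * (deriv ^^ 2) f z / deriv f z)"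
proof -
  have hol: "f holomorphic_on unit_disk"
    using f by (simp add: class_A_def analytic_on_open)
  have f_nz: "f z \<noteq> 0" and df_nz: "deriv f z \<noteq> 0"
    using fnz dnz z by (auto simp: starlike_quot_analytic_def convex_quot_analytic_def)
  have d1: "(f has_field_derivative deriv f z) (at z)"
    using hol z by (auto intro: holomorphic_derivI)
  have d2: "(deriv f has_field_derivative deriv (deriv f) z) (at z)"
    using holomorphic_deriv[OF hol] z by (auto intro: holomorphic_derivI)
  have "((\<lambda>z. z * deriv f z / f z) has_field_derivative
      ((deriv f z + z * deriv (deriv f) z) * f z - z * deriv f z * deriv f z) / (f z * f z)) (at z)"
    using f_nz by (auto intro!: derivative_eq_intros d1 d2 simp: algebra_simps)
  moreover have "\<forall>\<^sub>F w in nhds z. starlike_quot f w = w * deriv f w / f w"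
    using t1_space_nhds[OF z(2)] by eventually_elim (simp add: starlike_quot_def)
  ultimately have deriv_quot: "deriv (starlike_quot f) z
      = ((deriv f z + z * deriv (deriv f) z) * f z - z * deriv f z * deriv f z) / (f z * f z)"
    by (subst deriv_cong_ev[OF _ refl]) (auto intro: DERIV_imp_deriv)
  show ?thesis
    unfolding deriv_quot using z(2) f_nz df_nz
    by (simp add: starlike_quot_def eval_nat_numeral field_simps)
qed

text \<open>
  With \<open>q = z f'' / f'\<close> the quotient rule gives \<open>z q' = q + z\<^sup>2 f''' / f' - q\<^sup>2\<close>, and its last
  term cancels the square coming from \<open>(1 + q)\<^sup>2\<close>.
\<close>

lemma convex_quot_subordination:
  assumes f: "f \<in> class_A" and dnz: "convex_quot_analytic f" and z: "z \<in> unit_disk"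
  shows "(convex_quot f z)\<^sup>2 + convex_quot f z + z * deriv (convex_quot f) z - 2
    = z^2 * (deriv ^^ 3) f z / deriv f z + 4 * (z * (deriv ^^ 2) f z / deriv f z)"
proof -
  have hol: "f holomorphic_on unit_disk"
    using f by (simp add: class_A_def analytic_on_open)
  have df_nz: "deriv f z \<noteq> 0"
    using dnz z by (auto simp: convex_quot_analytic_def)
  have d2: "(deriv f has_field_derivative deriv (deriv f) z) (at z)"
    using holomorphic_deriv[OF hol] z by (auto intro: holomorphic_derivI)
  have d3: "(deriv (deriv f) has_field_derivative deriv (deriv (deriv f)) z) (at z)"
    using holomorphic_deriv[OF holomorphic_deriv[OF hol]] z by (auto intro: holomorphic_derivI)
  have "convex_quot f = (\<lambda>z. 1 + z * deriv (deriv f) z / deriv f z)"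
    by (simp add: fun_eq_iff convex_quot_def numeral_2_eq_2)
  moreover have "((\<lambda>z. 1 + z * deriv (deriv f) z / deriv f z) has_field_derivative
      ((deriv (deriv f) z + z * deriv (deriv (deriv f)) z) * deriv f z
        - z * deriv (deriv f) z * deriv (deriv f) z) / (deriv f z * deriv f z)) (at z)"
    using df_nz by (auto intro!: derivative_eq_intros d2 d3 simp: algebra_simps)
  ultimately have deriv_quot: "deriv (convex_quot f) z
      = ((deriv (deriv f) z + z * deriv (deriv (deriv f)) z) * deriv f z
        - z * deriv (deriv f) z * deriv (deriv f) z) / (deriv f z * deriv f z)"
    by (simp add: DERIV_imp_deriv)
  show ?thesis
    unfolding deriv_quot using df_nz
    by (simp add: convex_quot_def eval_nat_numeral field_simps)
qed

lemma ratio_quot_holomorphic: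
  assumes "f \<in> class_A"
  shows "ratio_quot f holomorphic_on unit_disk"
proof -
  have "f holomorphic_on unit_disk"
    using assms by (simp add: class_A_def analytic_on_open)
  hence "(\<lambda>z. if z = 0 then deriv f 0 else (f z - f 0) / (z - 0)) holomorphic_on unit_disk"
    by (rule pole_lemma) simp
  moreover have "(\<lambda>z. if z = 0 then deriv f 0 else (f z - f 0) / (z - 0)) = ratio_quot f"
    using assms by (auto simp: class_A_def ratio_quot_def fun_eq_iff)
  ultimately show ?thesis
    by simp
qed

text \<open>This is the product rule applied to \<open>f z = z * ratio_quot f z\<close>.\<close>

lemma deriv_eq_ratio_quot:
  assumes f: "f \<in> class_A" and z: "z \<in> unit_disk"
  shows "deriv f z = ratio_quot f z + z * deriv (ratio_quot f) z"
proof -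
  have "f = (\<lambda>z. z * ratio_quot f z)"
    using f by (auto simp: class_A_def ratio_quot_def fun_eq_iff)
  moreover have "(ratio_quot f has_field_derivative deriv (ratio_quot f) z) (at z)"
    using ratio_quot_holomorphic[OF f] z by (auto intro: holomorphic_derivI)
  hence "((\<lambda>z. z * ratio_quot f z) has_field_derivative
      ratio_quot f z + z * deriv (ratio_quot f) z) (at z)"
    by (auto intro!: derivative_eq_intros)
  ultimately show ?thesis
    by (metis DERIV_imp_deriv)
qed

theorem corollary1:
  fixes f :: "complex \<Rightarrow> complex"
  assumes "f \<in> class_A"
  shows
    "(starlike_quot_analytic f \<longrightarrow> convex_quot_analytic f \<longrightarrow>
       (\<forall>z\<in>unit_disk.
          norm (starlike_quot f z * (2 + z * (deriv ^^ 2) f z / deriv f z) - 2) < 5 / 2) \<longrightarrow>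
       f \<in> starlike_class) \<and>
     (convex_quot_analytic f \<longrightarrow>
       (\<forall>z\<in>unit_disk.
          norm (z^2 * (deriv ^^ 3) f z / deriv f z + 4 * (z * (deriv ^^ 2) f z / deriv f z)) < 5 / 2) \<longrightarrow>
       f \<in> convex_class) \<and>
     ((\<forall>z\<in>unit_disk.
          norm (z * (deriv ^^ 2) f z + deriv f z + (deriv f z)^2 - 2) < 5 / 2) \<longrightarrow>
       (\<forall>z\<in>unit_disk. Re (deriv f z) > 0)) \<and>
     ((\<forall>z\<in>unit_disk.
          norm (deriv f z + (ratio_quot f z)^2 - 2) < 5 / 2) \<longrightarrow>
       (\<forall>z\<in>unit_disk. Re (ratio_quot f z) > 0))"
proof (intro conjI impI ballI)
  have hol: "f holomorphic_on unit_disk" and f0: "f 0 = 0" and d0: "deriv f 0 = 1"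
    using assms by (auto simp: class_A_def analytic_on_open)
  show "f \<in> starlike_class"
    if fnz: "starlike_quot_analytic f" and dnz: "convex_quot_analytic f"
      and b: "\<forall>z\<in>unit_disk.
        norm (starlike_quot f z * (2 + z * (deriv ^^ 2) f z / deriv f z) - 2) < 5 / 2"
  proof -
    have "starlike_quot f holomorphic_on unit_disk"
      using starlike_quot_analytic_imp[OF assms fnz] by (simp add: analytic_on_open)
    hence "Re (starlike_quot f z) > 0" if "z \<in> unit_disk" for z
      using that b by (intro Re_pos_of_subordination)
        (auto simp: starlike_quot_def[of f 0] starlike_quot_subordination[OF assms fnz dnz])
    thus ?thesis
      using assms fnz by (simp add: starlike_class_def)
  qed
  show "f \<in> convex_class"
    if dnz: "convex_quot_analytic f"
      and b: "\<forall>z\<in>unit_disk. norm (z^2 * (deriv ^^ 3) f z / deriv f z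
        + 4 * (z * (deriv ^^ 2) f z / deriv f z)) < 5 / 2"
  proof -
    have "convex_quot f holomorphic_on unit_disk"
      using convex_quot_analytic_imp[OF assms dnz] by (simp add: analytic_on_open)
    hence "Re (convex_quot f z) > 0" if "z \<in> unit_disk" for z
      using that b by (intro Re_pos_of_subordination)
        (auto simp: convex_quot_def[of f 0] convex_quot_subordination[OF assms dnz])
    thus ?thesis
      using assms dnz by (simp add: convex_class_def)
  qed
  show "Re (deriv f z) > 0"
    if b: "\<forall>z\<in>unit_disk. norm (z * (deriv ^^ 2) f z + deriv f z + (deriv f z)^2 - 2) < 5 / 2"
      and z: "z \<in> unit_disk" for z
  proof (rule Re_pos_of_subordination[OF holomorphic_deriv[OF hol] d0 _ z])
    show "norm ((deriv f w)\<^sup>2 + deriv f w + w * deriv (deriv f) w - 2) < 5 / 2"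
      if "w \<in> unit_disk" for w
      using b that by (simp add: numeral_2_eq_2 add_ac)
  qed simp
  show "Re (ratio_quot f z) > 0"
    if b: "\<forall>z\<in>unit_disk. norm (deriv f z + (ratio_quot f z)^2 - 2) < 5 / 2"
      and z: "z \<in> unit_disk" for z
  proof (rule Re_pos_of_subordination[OF ratio_quot_holomorphic[OF assms] _ _ z])
    show "ratio_quot f 0 = 1"
      by (simp add: ratio_quot_def)
    show "norm ((ratio_quot f w)\<^sup>2 + ratio_quot f w + w * deriv (ratio_quot f) w - 2) < 5 / 2"
      if "w \<in> unit_disk" for w
      using b that by (simp add: deriv_eq_ratio_quot[OF assms] add_ac)
  qed
qed

end
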